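(* Let $V_{\pi^*}(\mathbf{x},t)$ be the optimal value function of the STA-HMDP defined in the context. Then, for states $\mathbf{x}=(\mathbf{n},k^+,p)$ and decision epochs $t\in D$, $V_{\pi^*}$ has the form $$V_{\pi^*}(\mathbf{x},t)=\begin{cases}\Pr(\mathtt{fin}(k^+)\mid t)\cdot\big(p-p^*_{cr}(\mathbf{n},k^+,t)\big)+Q_{\pi^*}(\mathbf{n},\mathtt{rej},t), & \text{if } k^+\neq\bot \text{ and } p\ge p^*_{cr}(\mathbf{n},k^+,t),\\ Q_{\pi^*}(\mathbf{n},\mathtt{rej},t), & \text{otherwise,}\end{cases}$$ where $p^*_{cr}$ is the critical price function, defined as $$p^*_{cr}(\mathbf{n},k^+,t)=\frac{1}{\Pr(\mathtt{fin}(k^+)\mid t)}\Big(Q_{\pi^*}(\mathbf{n},\mathtt{rej},t)-Q_{\pi^*}(\mathbf{n}+e_{k^+},\mathtt{rej},t)\Big)$$ if $k^+\neq\bot$ and $t<t_H$, and $p^*_{cr}(\mathbf{n},k^+,t)=0$ if $k^+=\bot$ or $t=t_H$.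
   Context: Parameters: a number $N_{serv}$ of identical servers; a finite set of task classes $K=\{1,\dots,|K|\}$; for each $k\in K$ an exponential service rate $\mu_k$, a finite Lipschitz continuous arrival rate function $\Lambda_k(t)$ of an inhomogeneous Poisson process, and a price density $f_k$ on $[0,\infty)$ with cumulative distribution function $F_k$; a finite horizon $t_H$; and a finite sequence of decision epochs $D=\{t_0,t_1,\dots,t_H\}$ with constant step $\Delta t=t_{i+1}-t_i$. The STA-HMDP (Stochastic Task Admission hybrid Markov decision process) is the following finite-horizon, discrete-time MDP. States: $\mathbf{x}=(\mathbf{n},k^+,p)$, where $\mathbf{n}=(n_1,\dots,n_{|K|})\in\mathbf{N}$, $\mathbf{N}=\{\mathbf{n}\in\mathbb{Z}_{\ge0}^{|K|}:\sum_k n_k\le N_{serv}\}$ ($n_k$ is the number of servers processing a class-$k$ task), $k^+\in K\cup\{\bot\}$ is the class of the task that has arrived since the last decision epoch ($\bot$ if none), and $p\in[0,\infty)$ is its price ($p=0$ if $k^+=\bot$). Actions: $A=\{\mathtt{acc},\mathtt{rej}\}$ (accept or reject the task); $\mathtt{acc}$ can only be executed if $k^+\ne\bot$ and $\sum_k n_k<N_{serv}$. For $k\in K$, $\Pr(\mathtt{fin}(k)\mid t)=1-\exp(-(t_H-t)\mu_k)$ is the probability that a class-$k$ task is completed before the horizon, and $e_k$ denotes the $k$-th standard unit vector. Rejecting gives reward $0$. Transitions under $\mathtt{rej}$ from epoch $t_i$ to $t_{i+1}$: the new state $(\mathbf{n}',k'^+,p')$ has law $\Pr(k'^+\mid t_i)\cdot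 f_{k'^+}(p')\cdot\prod_{k\in K}\Pr(n'_k\mid n_k)$, where $\Pr(\bot\mid t_i)=\exp(-\Delta t\sum_{k}\Lambda_k(t_i))$; $\Pr(k'\mid t_i)=\frac{\Lambda_{k'}(t_i)}{\sum_k\Lambda_k(t_i)}\big(1-\Pr(\bot\mid t_i)\big)$ for $k'\in K$; given $k'^+=\bot$ the price is $0$; and $\Pr(n'_k\mid n_k)=\binom{n_k}{n_k-n'_k}(1-e^{-\mu_k\Delta t})^{n_k-n'_k}e^{-\mu_k n'_k\Delta t}$ if $n'_k\le n_k$, and $0$ otherwise. Optimal values: $Q_{\pi^*}(\mathbf{n},\mathtt{rej},t_H)=0$; for $t_i<t_H$, $Q_{\pi^*}(\mathbf{n},\mathtt{rej},t_i)$ is the expectation of $V_{\pi^*}(\mathbf{x}',t_{i+1})$ over the next state $\mathbf{x}'$ drawn from the $\mathtt{rej}$-transition law (it depends on the current state only through $\mathbf{n}$, and $Q_{\pi^*}(\mathbf{x},\mathtt{rej},t)=Q_{\pi^*}(\mathbf{n},\mathtt{rej},t)$). Accepting yields the reward $p\cdot\Pr(\mathtt{fin}(k^+)\mid t)$ and an instantaneous transition, at the same epoch, to the state with task combination $\mathbf{n}+e_{k^+}$ and no task available: $$Q_{\pi^*}(\mathbf{x},\mathtt{acc},t)=p\cdot\Pr(\mathtt{fin}(k^+)\mid t)+V_{\pi^*}\big((\mathbf{n}+e_{k^+},\bot,0),t\big).$$ $V_{\pi^*}(\mathbf{x},t)$ is the maximum of $Q_{\pi^*}(\mathbf{x},a,t)$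 over the actions $a\in A$ that can be executed at $\mathbf{x}$.
   Formalization: When all servers are busy and t<t_H, Q(n+e_k,rej,t) in the critical price is undefined; it is read there as −∞, so the critical price is +∞ and V=Q(n,rej,t). Values are taken in the extended reals, since prices are not assumed to have finite mean. *)

theory Defs
  imports "HOL-Analysis.Analysis"
begin

(* The finite index type 'k is the set K of task classes. The decision epochs are
   t_i = first_epoch + i * step for i <= num_steps, so the horizon is t_H with H = num_steps. *)
record 'k sta_hmdp =
  num_servers :: nat
  service_rate :: "'k \<Rightarrow> real"
  arrival_rate :: "'k \<Rightarrow> real \<Rightarrow> real"
  price_density :: "'k \<Rightarrow> real \<Rightarrow> real"
  first_epoch :: real
  step :: real
  num_steps :: nat

definition epoch :: "'k sta_hmdp \<Rightarrow> nat \<Rightarrow> real" where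
  "epoch M i = first_epoch M + real i * step M"

definition horizon :: "'k sta_hmdp \<Rightarrow> real" where
  "horizon M = epoch M (num_steps M)"

definition wf_sta_hmdp :: "('k::finite) sta_hmdp \<Rightarrow> bool" where
  "wf_sta_hmdp M \<longleftrightarrow>
     step M > 0 \<and>
     (\<forall>k. service_rate M k > 0) \<and>
     (\<forall>k. \<forall>t\<in>{first_epoch M..horizon M}. arrival_rate M k t \<ge> 0) \<and>
     (\<forall>k. \<exists>L. L-lipschitz_on {first_epoch M..horizon M} (arrival_rate M k)) \<and>
     (\<forall>k. price_density M k \<in> borel_measurable borel) \<and>
     (\<forall>k. \<forall>p\<ge>0. price_density M k p \<ge> 0) \<and>
     (\<forall>k. (\<integral>\<^sup>+p\<in>{0..}. ennreal (price_density M k p) \<partial>lborel) = 1)"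

(* States (n, k, p): None stands for "no task has arrived". *)
type_synonym 'k state = "(nat ^ 'k) \<times> 'k option \<times> real"

datatype action = Acc | Rej

definition task_combs :: "('k::finite) sta_hmdp \<Rightarrow> (nat ^ 'k) set" where
  "task_combs M = {n. (\<Sum>k\<in>UNIV. n $ k) \<le> num_servers M}"

definition states :: "('k::finite) sta_hmdp \<Rightarrow> 'k state set" where
  "states M = {(n, kp, p). n \<in> task_combs M \<and> p \<ge> 0 \<and> (kp = None \<longrightarrow> p = 0)}"

fun executable :: "('k::finite) sta_hmdp \<Rightarrow> 'k state \<Rightarrow> action set" where
  "executable M (n, kp, p) =
     {Rej} \<union> (if kp \<noteq> None \<and> (\<Sum>k\<in>UNIV. n $ k) < num_servers M then {Acc} else {})"

definition pr_fin :: "'k sta_hmdp \<Rightarrow> 'k \<Rightarrow> real \<Rightarrow> real" where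
  "pr_fin M k t = 1 - exp (- (horizon M - t) * service_rate M k)"

definition pr_no_arrival :: "('k::finite) sta_hmdp \<Rightarrow> real \<Rightarrow> real" where
  "pr_no_arrival M t = exp (- step M * (\<Sum>k\<in>UNIV. arrival_rate M k t))"

(* If the total arrival rate is 0, this is 0 because x / 0 = 0, as it should be. *)
definition pr_arrival :: "('k::finite) sta_hmdp \<Rightarrow> 'k \<Rightarrow> real \<Rightarrow> real" where
  "pr_arrival M k t =
     arrival_rate M k t / (\<Sum>j\<in>UNIV. arrival_rate M j t) * (1 - pr_no_arrival M t)"

definition pr_remain :: "'k sta_hmdp \<Rightarrow> 'k \<Rightarrow> nat \<Rightarrow> nat \<Rightarrow> real" where
  "pr_remain M k m m' =
     (if m' \<le> m
      then real (m choose (m - m')) * (1 - exp (- service_rate M k * step M)) ^ (m - m')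
           * exp (- service_rate M k * real m' * step M)
      else 0)"

(* Expectation of g over the successor state under Rej at time t. Since all rewards are
   nonnegative, so are the optimal values on states (opt_V_nonneg below), and their expectation
   is a Lebesgue integral with values in [0, \<infinity>]; no finite mean of the price is
   needed for it to make sense. The truncation by e2ennreal has no effect. *)
definition rej_expectation ::
    "('k::finite) sta_hmdp \<Rightarrow> nat ^ 'k \<Rightarrow> real \<Rightarrow> ('k state \<Rightarrow> ereal) \<Rightarrow> ereal" where
  "rej_expectation M n t g = enn2ereal
     (\<Sum>n'\<in>task_combs M. ennreal (\<Prod>k\<in>UNIV. pr_remain M k (n $ k) (n' $ k)) *
        (ennreal (pr_no_arrival M t) * e2ennreal (g (n', None, 0)) +
         (\<Sum>k'\<in>UNIV. ennreal (pr_arrival M k' t) *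
            (\<integral>\<^sup>+p'\<in>{0..}. ennreal (price_density M k' p')
               * e2ennreal (g (n', Some k', p')) \<partial>lborel))))"

(* Optimal values at the i-th epoch. opt_Q_rej M n i is Q(n, rej, t_i); it is -\<infinity>
   for n outside task_combs, so that opt_Q_rej M (n + axis k 1) i, and hence crit_price below,
   is also defined if all servers are busy. The value of opt_Q for Acc without
   a task is irrelevant, as Acc is not executable then. *)
function opt_Q_rej :: "('k::finite) sta_hmdp \<Rightarrow> nat ^ 'k \<Rightarrow> nat \<Rightarrow> ereal"
  and opt_Q :: "'k sta_hmdp \<Rightarrow> 'k state \<Rightarrow> action \<Rightarrow> nat \<Rightarrow> ereal"
  and opt_V :: "'k sta_hmdp \<Rightarrow> 'k state \<Rightarrow> nat \<Rightarrow> ereal" where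
  "opt_Q_rej M n i =
     (if n \<notin> task_combs M then -\<infinity>
      else if i < num_steps M
        then rej_expectation M n (epoch M i) (\<lambda>x'. opt_V M x' (Suc i))
      else 0)"
| "opt_Q M (n, kp, p) a i =
     (case a of
        Rej \<Rightarrow> opt_Q_rej M n i
      | Acc \<Rightarrow> (case kp of
          None \<Rightarrow> -\<infinity>
        | Some k \<Rightarrow> ereal (p * pr_fin M k (epoch M i)) + opt_V M (n + axis k 1, None, 0) i))"
| "opt_V M x i = Max ((\<lambda>a. opt_Q M x a i) ` executable M x)"
  by pat_completeness auto
termination
  by (relation "Wellfounded.measure (\<lambda>s. case s of
        Inl (M, n, i) \<Rightarrow> 5 * (num_steps M - i)
      | Inr (Inl (M, (n, kp, p), a, i)) \<Rightarrow> 5 * (num_steps M - i) + (if kp = None then 1 else 3)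
      | Inr (Inr (M, (n, kp, p), i)) \<Rightarrow> 5 * (num_steps M - i) + (if kp = None then 2 else 4))")
     auto

declare opt_Q_rej.simps [simp del] opt_Q.simps [simp del] opt_V.simps [simp del]

definition crit_price ::
    "('k::finite) sta_hmdp \<Rightarrow> nat ^ 'k \<Rightarrow> 'k option \<Rightarrow> nat \<Rightarrow> ereal" where
  "crit_price M n kp i =
     (case kp of
        None \<Rightarrow> 0
      | Some k \<Rightarrow>
          if i < num_steps M
          then ereal (1 / pr_fin M k (epoch M i))
               * (opt_Q_rej M n i - opt_Q_rej M (n + axis k 1) i)
          else 0)"

lemma finite_task_combs: "finite (task_combs M)"
proof -
  have "task_combs M \<subseteq> vec_lambda ` (UNIV \<rightarrow>\<^sub>E {..num_servers M})"
  proof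
    fix n assume "n \<in> task_combs M"
    then have "n $ k \<le> num_servers M" for k
      using member_le_sum[of k UNIV "\<lambda>k. n $ k"] by (fastforce simp: task_combs_def)
    then have "vec_nth n \<in> UNIV \<rightarrow>\<^sub>E {..num_servers M}" by auto
    then show "n \<in> vec_lambda ` (UNIV \<rightarrow>\<^sub>E {..num_servers M})"
      by (metis image_eqI vec_nth_inverse)
  qed
  then show ?thesis by (rule finite_subset) (auto intro!: finite_imageI finite_PiE)
qed

lemma opt_Q_rej_nonneg: "n \<in> task_combs M \<Longrightarrow> opt_Q_rej M n i \<ge> 0"
  by (auto simp: opt_Q_rej.simps rej_expectation_def)

lemma opt_V_nonneg:
  assumes "x \<in> states M"
  shows "opt_V M x i \<ge> 0"
proof -
  obtain n kp p where x: "x = (n, kp, p)" by (cases x)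
  have "0 \<le> opt_Q M x Rej i"
    using assms by (auto simp: x states_def opt_Q.simps intro: opt_Q_rej_nonneg)
  also have "\<dots> \<le> opt_V M x i"
    unfolding opt_V.simps by (intro Max_ge) (auto simp: x)
  finally show ?thesis .
qed

(* The transition law of Rej has total mass 1. *)

lemma sum_pr_remain:
  assumes "service_rate M k > 0" "step M > 0"
  shows "(\<Sum>m'\<le>m. pr_remain M k m m') = 1"
proof -
  let ?q = "exp (- service_rate M k * step M)"
  have "(\<Sum>m'\<le>m. pr_remain M k m m') = (\<Sum>m'\<le>m. real (m choose m') * ?q ^ m' * (1 - ?q) ^ (m - m'))"
    by (intro sum.cong) (auto simp: pr_remain_def binomial_symmetric[symmetric] exp_of_nat_mult[symmetric] mult_ac)
  also have "\<dots> = (?q + (1 - ?q)) ^ m" by (subst binomial_ring) (simp add: mult_ac)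
  finally show ?thesis by simp
qed

lemma sum_prod_pr_remain:
  assumes wf: "wf_sta_hmdp M" and n: "n \<in> task_combs M"
  shows "(\<Sum>n'\<in>task_combs M. \<Prod>k\<in>UNIV. pr_remain M k (n $ k) (n' $ k)) = 1"
proof -
  let ?B = "{n'. \<forall>k. n' $ k \<le> n $ k}"
  have sub: "?B \<subseteq> task_combs M"
    using n by (auto simp: task_combs_def intro: order_trans[OF sum_mono])
  have "(\<Sum>n'\<in>task_combs M. \<Prod>k\<in>UNIV. pr_remain M k (n $ k) (n' $ k)) =
        (\<Sum>n'\<in>?B. \<Prod>k\<in>UNIV. pr_remain M k (n $ k) (n' $ k))"
    using sub finite_task_combs by (intro sum.mono_neutral_right) (auto simp: pr_remain_def)
  also have "\<dots> = (\<Sum>g\<in>PiE UNIV (\<lambda>k. {..n $ k}). \<Prod>k\<in>UNIV. pr_remain M k (n $ k) (g k))"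
    by (intro sum.reindex_bij_witness[of _ "vec_lambda" "vec_nth"]) auto
  also have "\<dots> = (\<Prod>k\<in>UNIV. \<Sum>m'\<le>n $ k. pr_remain M k (n $ k) m')"
    by (rule prod_sum_PiE[symmetric]) auto
  also have "\<dots> = 1"
    using wf by (intro prod.neutral ballI sum_pr_remain) (auto simp: wf_sta_hmdp_def)
  finally show ?thesis .
qed

lemma rej_expectation_1:
  assumes wf: "wf_sta_hmdp M" and n: "n \<in> task_combs M" and i: "i \<le> num_steps M"
  shows "rej_expectation M n (epoch M i) (\<lambda>_. 1) = 1"
proof -
  let ?t = "epoch M i"
  let ?L = "\<Sum>k\<in>UNIV. arrival_rate M k ?t"
  have st: "step M > 0" using wf by (simp add: wf_sta_hmdp_def)
  have "?t \<in> {first_epoch M..horizon M}"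
    using st i by (auto simp: epoch_def horizon_def)
  then have rate: "arrival_rate M k ?t \<ge> 0" for k
    using wf by (auto simp: wf_sta_hmdp_def)
  have L: "?L \<ge> 0" by (intro sum_nonneg rate)
  have no: "0 \<le> pr_no_arrival M ?t" "pr_no_arrival M ?t \<le> 1"
    using st L by (auto simp: pr_no_arrival_def)
  have arr: "0 \<le> pr_arrival M k ?t" for k
    using no rate L by (auto simp: pr_arrival_def)
  have sum_arr: "(\<Sum>k\<in>UNIV. pr_arrival M k ?t) = 1 - pr_no_arrival M ?t"
    by (cases "?L = 0") (simp_all add: pr_arrival_def pr_no_arrival_def
        sum_distrib_right[symmetric] sum_divide_distrib[symmetric])
  have rem: "0 \<le> pr_remain M k m m'" for k m m'
    using wf by (auto simp: pr_remain_def wf_sta_hmdp_def less_imp_le intro!: mult_nonneg_nonneg zero_le_power)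
  have dens: "(\<integral>\<^sup>+p\<in>{0..}. ennreal (price_density M k p) \<partial>lborel) = 1" for k
    using wf by (simp add: wf_sta_hmdp_def)
  have inner: "ennreal (pr_no_arrival M ?t) + (\<Sum>k\<in>UNIV. ennreal (pr_arrival M k ?t)) = 1"
    using no arr by (simp add: sum_ennreal sum_arr ennreal_plus[symmetric] sum_nonneg del: ennreal_plus)
  have e1: "e2ennreal 1 = 1"
    by (simp add: one_ennreal_def)
  show ?thesis
    using sum_prod_pr_remain[OF wf n] rem
    by (simp add: rej_expectation_def e1 dens inner sum_ennreal prod_nonneg one_ennreal.rep_eq)
qed

end

theory Submission
  imports Defs
begin

text \<open>
  With \<open>A = Q(n, rej, t)\<close>, \<open>B = Q(n + e\<^sub>k, rej, t)\<close> and \<open>c = Pr(fin(k) | t) > 0\<close>, accepting is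
  worth \<open>c p + B = c (p - (A - B) / c) + A\<close>, which is at least \<open>A\<close> iff \<open>p\<close> is at least the
  critical price. The values \<open>A\<close> and \<open>B\<close> may be \<open>\<infinity>\<close>, and \<open>B = -\<infinity>\<close> if all servers are busy;
  since \<open>\<infinity> - \<infinity> = \<infinity>\<close> in \<^typ>\<open>ereal\<close>, the formula survives in these cases.
\<close>

lemma pr_fin_pos:
  assumes "wf_sta_hmdp M" "i < num_steps M"
  shows "0 < pr_fin M k (epoch M i)"
proof -
  have "epoch M i < horizon M" and "0 < service_rate M k"
    using assms by (auto simp: wf_sta_hmdp_def horizon_def epoch_def)
  then show ?thesis by (simp add: pr_fin_def mult_neg_pos)
qed

lemma pr_fin_horizon [simp]: "pr_fin M k (epoch M (num_steps M)) = 0"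
  by (simp add: pr_fin_def horizon_def)

lemma opt_V_None: "opt_V M (n, None, p) i = opt_Q_rej M n i"
  by (simp add: opt_V.simps opt_Q.simps)

text \<open>Accepting leads to a state without a task, where only \<open>Rej\<close> is executable,
  so its value is an \<open>opt_Q_rej\<close>.\<close>

lemma opt_V_Some:
  "opt_V M (n, Some k, p) i =
     (if (\<Sum>j\<in>UNIV. n $ j) < num_servers M
      then max (ereal (p * pr_fin M k (epoch M i)) + opt_Q_rej M (n + axis k 1) i)
               (opt_Q_rej M n i)
      else opt_Q_rej M n i)"
  by (simp add: opt_V.simps[of M "(n, Some k, p)"] opt_Q.simps opt_V_None max.commute)

lemma add_axis_in_task_combs_iff:
  "n + axis k 1 \<in> task_combs M \<longleftrightarrow> (\<Sum>j\<in>UNIV. n $ j) < num_servers M"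
  by (auto simp: task_combs_def sum.distrib axis_def)

lemma max_accept_reject:
  fixes A B :: ereal and c p :: real
  assumes "0 < c" and "0 \<le> A"
  shows "max (ereal (p * c) + B) A =
    (if ereal (1 / c) * (A - B) \<le> ereal p
     then ereal c * (ereal p - ereal (1 / c) * (A - B)) + A
     else A)"
  using assms by (cases A; cases B) (auto simp: field_simps max_def)

theorem proposition1:
  fixes M :: "('k::finite) sta_hmdp" and n :: "nat ^ 'k" and kp :: "'k option" and p :: real
    and i :: nat
  assumes "wf_sta_hmdp M" and "(n, kp, p) \<in> states M" and "i \<le> num_steps M"
  shows "opt_V M (n, kp, p) i =
    (if kp \<noteq> None \<and> ereal p \<ge> crit_price M n kp i
     then ereal (pr_fin M (the kp) (epoch M i)) * (ereal p - crit_price M n kp i)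
          + opt_Q_rej M n i
     else opt_Q_rej M n i)"
proof (cases kp)
  case None
  then show ?thesis by (simp add: opt_V_None)
next
  case (Some k)
  have n: "n \<in> task_combs M" and p: "0 \<le> p"
    using assms(2) by (auto simp: states_def)
  show ?thesis
  proof (cases "i < num_steps M")
    case True
    let ?c = "pr_fin M k (epoch M i)"
    have "opt_V M (n, kp, p) i =
        max (ereal (p * ?c) + opt_Q_rej M (n + axis k 1) i) (opt_Q_rej M n i)"
    proof (cases "n + axis k 1 \<in> task_combs M")
      case True
      then show ?thesis unfolding add_axis_in_task_combs_iff by (simp add: Some opt_V_Some)
    next
      case False
      \<comment> \<open>With all servers busy, the value -\<infinity> lets the maximum collapse to
        rejection, matching that \<open>Acc\<close> is not executable.\<close>
      then have "opt_Q_rej M (n + axis k 1) i = -\<infinity>"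
        by (simp add: opt_Q_rej.simps)
      with False show ?thesis
        unfolding add_axis_in_task_combs_iff by (simp add: Some opt_V_Some)
    qed
    then show ?thesis
      using True max_accept_reject[OF pr_fin_pos[OF assms(1) True] opt_Q_rej_nonneg[OF n]]
      by (simp add: Some crit_price_def)
  next
    case False
    then have i: "i = num_steps M" using assms(3) by simp
    \<comment> \<open>At the horizon \<open>pr_fin\<close> is 0 and \<open>opt_Q_rej\<close> is 0 or
      -\<infinity>, so accepting gains nothing.\<close>
    have "opt_V M (n, kp, p) i = opt_Q_rej M n i"
      using n by (auto simp: Some opt_V_Some i opt_Q_rej.simps)
    \<comment> \<open>Since \<open>crit_price\<close> is 0 here, the first branch applies, with
      factor 0.\<close>
    then show ?thesis by (simp add: Some i p crit_price_def)
  qed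
qed

end
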